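(* A function $u=\sum_{n=0}^\infty c_nf_n\in C_0(O,\overline{K}_c)$ belongs to $A(O,\overline{K}_c)$ if and only if $$q^{\frac{q^n}{q-1}}|c_n|\to 0\quad\text{for } n\to\infty .$$
   Context: Let $\mathbf F_q$ be the finite field with $q=p^\gamma$ elements ($p$ prime, $\gamma\ge 1$), and let $K=\mathbf F_q((x))$ with absolute value $|z|=q^{-n}$ for $z=\sum_{i=n}^\infty\zeta_i x^i$, $\zeta_i\in\mathbf F_q$, $\zeta_n\neq 0$. Let $O=\{z\in K:|z|\le1\}$ and let $\overline{K}_c$ be the completion of an algebraic closure of $K$, with the extended absolute value. A function $u:O\to\overline{K}_c$ is $\mathbf F_q$-linear if $u(t_1+t_2)=u(t_1)+u(t_2)$ and $u(\alpha t)=\alpha u(t)$ for all $t,t_1,t_2\in O$, $\alpha\in\mathbf F_q$. $C_0(O,\overline{K}_c)$ is the Banach space of all continuous $\mathbf F_q$-linear functions $O\to\overline{K}_c$ with the supremum norm. Put $[i]=x^{q^i}-x$, $D_0=1$, $D_i=[i]\,[i-1]^q\cdots[1]^{q^{i-1}}$ for $i\ge1$. The normalized Carlitz polynomials are $f_i(t)=D_i^{-1}e_i(t)$, $i\ge 0$, where $e_0(t)=t$ and $e_i(t)=\prod_{m\in\mathbf F_q[x],\,\deg m<i}(t-m)$ for $i\ge1$ (the product includes $m=0$). It is known that every $u\in C_0(O,\overline{K}_c)$ has a unique uniformly convergent expansion $u=\sum_{n\ge0}c_nf_n$ with $c_n\in\overline{K}_c$, $c_n\to0$, and $\|u\|=\sup_n|c_n|$;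 the $c_n$ in the claim are these coefficients. $A(O,\overline{K}_c)\subset C_0(O,\overline{K}_c)$ denotes the space of all functions $O\to\overline{K}_c$ of the form $u(t)=\sum_{n=0}^\infty a_nt^{q^n}$ with $a_n\in\overline{K}_c$, $a_n\to0$. *)

theory Defs
  imports
    "HOL-Analysis.Analysis"
    "HOL-Computational_Algebra.Computational_Algebra"
    "HOL-Algebra.Algebraic_Closure_Type"
begin

text \<open>
  The type variable 'a of sort {finite, field} plays the role of the finite field with
  q = CARD('a) elements, and 'a fls is the field K of formal Laurent series over it.
\<close>

definition laurent_abs :: "'a::{finite,field} fls \<Rightarrow> real" where
  "laurent_abs z = (if z = 0 then 0 else real CARD('a) powi (- fls_subdegree z))"

definition laurent_integers :: "'a::{finite,field} fls set" where
  "laurent_integers = {z. laurent_abs z \<le> 1}"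

text \<open>
  The type 'c, with absolute value dist z 0, is the completion of the algebraic closure of K:
  it is a complete valued field (completeness being part of its sort), and it contains the
  algebraic closure as a dense subfield (via j) in such a way that the absolute value extends
  the one of K. As K is complete, the extension of its absolute value to the algebraic closure
  is unique, so these conditions determine the valued field 'c up to isometric isomorphism.
\<close>

locale completed_alg_closure =
  fixes j :: "'a::{finite,field} fls alg_closure \<Rightarrow> 'c::{field,complete_space}"
  assumes j_1: "j 1 = 1"
    and j_add: "j (a + b) = j a + j b"
    and j_mult: "j (a * b) = j a * j b"
    and dist_diff: "dist (z::'c) w = dist (z - w) 0"
    and abs_mult: "dist (z * w :: 'c) 0 = dist z 0 * dist w 0"
    and ultrametric: "dist (z + w :: 'c) 0 \<le> max (dist z 0) (dist w 0)"
    and abs_extends: "dist (j (to_ac t)) 0 = laurent_abs t"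
    and dense: "closure (range j) = UNIV"

definition carlitz_bracket :: "nat \<Rightarrow> 'a::{finite,field} fls" where
  "carlitz_bracket i = fls_X ^ (CARD('a) ^ i) - fls_X"

definition carlitz_D :: "nat \<Rightarrow> 'a::{finite,field} fls" where
  "carlitz_D i = (\<Prod>k=1..i. carlitz_bracket k ^ (CARD('a) ^ (i - k)))"

definition carlitz_e :: "nat \<Rightarrow> 'a::{finite,field} fls \<Rightarrow> 'a fls" where
  "carlitz_e i t =
     (if i = 0 then t
      else (\<Prod>m\<in>{m :: 'a poly. Polynomial.degree m < i}. t - fps_to_fls (fps_of_poly m)))"

definition carlitz_f :: "nat \<Rightarrow> 'a::{finite,field} fls \<Rightarrow> 'a fls" where
  "carlitz_f i t = inverse (carlitz_D i) * carlitz_e i t"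

text \<open>
  In the following, functions on the ring of integers O are total functions on K whose values
  outside O are irrelevant. Continuity refers to the library metric on Laurent series, which
  uses the base 2 instead of q but induces the same topology as laurent_abs.
\<close>

definition Fq_linear ::
  "('a::{finite,field} fls alg_closure \<Rightarrow> 'c::field) \<Rightarrow> ('a fls \<Rightarrow> 'c) \<Rightarrow> bool" where
  "Fq_linear j u \<longleftrightarrow>
     (\<forall>t1\<in>laurent_integers. \<forall>t2\<in>laurent_integers. u (t1 + t2) = u t1 + u t2) \<and>
     (\<forall>\<alpha>. \<forall>t\<in>laurent_integers. u (fls_const \<alpha> * t) = j (to_ac (fls_const \<alpha>)) * u t)"

definition C0_space ::
  "('a::{finite,field} fls alg_closure \<Rightarrow> 'c::{field,complete_space}) \<Rightarrow> ('a fls \<Rightarrow> 'c) set" where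
  "C0_space j = {u. continuous_on laurent_integers u \<and> Fq_linear j u}"

definition carlitz_expansion ::
  "('a::{finite,field} fls alg_closure \<Rightarrow> 'c::{field,complete_space}) \<Rightarrow>
     ('a fls \<Rightarrow> 'c) \<Rightarrow> (nat \<Rightarrow> 'c) \<Rightarrow> bool" where
  "carlitz_expansion j u c \<longleftrightarrow>
     c \<longlonglongrightarrow> 0 \<and>
     uniform_limit laurent_integers
       (\<lambda>N t. \<Sum>n<N. c n * j (to_ac (carlitz_f n t))) u sequentially"

definition A_space ::
  "('a::{finite,field} fls alg_closure \<Rightarrow> 'c::{field,complete_space}) \<Rightarrow> ('a fls \<Rightarrow> 'c) set" where
  "A_space j =
     {u. \<exists>a. a \<longlonglongrightarrow> 0 \<and>
           (\<forall>t\<in>laurent_integers. (\<lambda>n. a n * j (to_ac t) ^ (CARD('a) ^ n)) sums u t)}"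

end

theory Submission
  imports Defs
begin

text \<open>
  Since \<open>\<bar>D\<^sub>n\<bar> = q powr ((1 - q ^ n) / (q - 1))\<close>, the growth condition says that the
  \<open>b\<^sub>n = c\<^sub>n / D\<^sub>n\<close> in \<open>u = (\<Sum>n. b\<^sub>n e\<^sub>n)\<close> tend to \<open>0\<close>. The recurrence
  \<open>e\<^sub>n\<^sub>+\<^sub>1 = e\<^sub>n\<^sup>q - e\<^sub>n(x\<^sup>n)\<^sup>q\<^sup>-\<^sup>1 e\<^sub>n\<close> shows that the
  \<open>e\<^sub>n\<close> and the monomials \<open>t ^ (q ^ n)\<close> are related by a unitriangular matrix over \<open>O\<close>, in
  both directions. In a complete ultrametric field such a matrix turns expansions with null
  coefficients into expansions with null coefficients. The coefficients \<open>c\<^sub>n\<close> are unique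
  because \<open>e\<^sub>n(x\<^sup>m)\<close> vanishes for \<open>m < n\<close> but not for \<open>m = n\<close>.
\<close>

section \<open>Triangular changes of basis in a complete ultrametric field\<close>

text \<open>Tying \<open>N\<close> to the metric of the type makes the library's limits and
  completeness available for it; nonnegativity and \<open>N 0 = 0\<close> are inherited from
  \<open>dist\<close>.\<close>

locale ultrametric_field =
  fixes N :: "'c::{field,complete_space} \<Rightarrow> real"
  assumes dist_eq: "dist z w = N (z - w)"
    and N_mult: "N (z * w) = N z * N w"
    and N_add: "N (z + w) \<le> max (N z) (N w)"
begin

lemma N_nonneg [simp]: "N z \<ge> 0"
  using dist_eq[of z 0] by (metis diff_zero zero_le_dist)

lemma N_zero [simp]: "N 0 = 0"
  using dist_eq[of 0 0] by simp

lemma N_uminus [simp]: "N (- z) = N z"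
  using dist_eq[of z 0] dist_eq[of 0 z] by (metis diff_0 diff_zero dist_commute)

lemma N_sum_le:
  assumes "B \<ge> 0" "\<And>i. i \<in> A \<Longrightarrow> N (f i) \<le> B"
  shows "N (\<Sum>i\<in>A. f i) \<le> B"
  using assms(2)
proof (induction A rule: infinite_finite_induct)
  case (insert x F)
  then have "N (f x) \<le> B" "N (\<Sum>i\<in>F. f i) \<le> B"
    by simp_all
  then show ?case
    using insert.hyps N_add[of "f x" "\<Sum>i\<in>F. f i"] by simp
qed (use assms(1) in auto)

lemma N_sum_diff_le:
  fixes f :: "nat \<Rightarrow> 'c"
  assumes "B \<ge> 0" "\<And>i. i \<ge> K \<Longrightarrow> N (f i) \<le> B" "K \<le> n" "K \<le> m"
  shows "N ((\<Sum>i<n. f i) - (\<Sum>i<m. f i)) \<le> B"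
proof -
  have *: "N ((\<Sum>i<n. f i) - (\<Sum>i<m. f i)) \<le> B" if "K \<le> m" "m \<le> n" for n m
  proof -
    have "(\<Sum>i<n. f i) - (\<Sum>i<m. f i) = (\<Sum>i\<in>{..<n} - {..<m}. f i)"
      using that by (subst sum_diff) auto
    then show ?thesis
      using that assms(1,2) by (auto intro!: N_sum_le)
  qed
  show ?thesis
    using *[of m n] *[of n m] assms(3,4) N_uminus[of "(\<Sum>i<n. f i) - (\<Sum>i<m. f i)"]
    by (cases "m \<le> n") auto
qed

lemma tendsto_zero_iff: "f \<longlonglongrightarrow> 0 \<longleftrightarrow> (\<lambda>n. N (f n)) \<longlonglongrightarrow> 0"
  by (simp add: lim_sequentially dist_eq)

lemma null_seqD:
  assumes "f \<longlonglongrightarrow> 0" "e > 0"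
  obtains K where "\<And>n. n \<ge> K \<Longrightarrow> N (f n) \<le> e"
  using metric_LIMSEQ_D[OF assms] dist_eq by (metis diff_zero less_imp_le)

text \<open>By the ultrametric inequality a difference of partial sums is bounded by its largest
  term, so null terms already make the partial sums Cauchy.\<close>

lemma sums_ex:
  fixes f :: "nat \<Rightarrow> 'c"
  assumes "f \<longlonglongrightarrow> 0"
  shows "\<exists>s. f sums s"
proof -
  have "Cauchy (\<lambda>n. \<Sum>i<n. f i)"
  proof (rule metric_CauchyI)
    fix e :: real assume "e > 0"
    \<comment> \<open>Halving \<open>e\<close> leaves room to pass from the non-strict ultrametric
      bound to the strict one in the Cauchy criterion.\<close>
    then obtain K where "\<And>n. n \<ge> K \<Longrightarrow> N (f n) \<le> e / 2"
      using null_seqD[OF assms, of "e / 2"] by auto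
    then have "N ((\<Sum>i<m. f i) - (\<Sum>i<n. f i)) \<le> e / 2" if "m \<ge> K" "n \<ge> K" for m n
      using \<open>e > 0\<close> that by (intro N_sum_diff_le[where K = K]) auto
    moreover have "e / 2 < e"
      using \<open>e > 0\<close> by simp
    ultimately have "dist (\<Sum>i<m. f i) (\<Sum>i<n. f i) < e" if "m \<ge> K" "n \<ge> K" for m n
      using that unfolding dist_eq by (meson order_le_less_trans)
    then show "\<exists>M. \<forall>m\<ge>M. \<forall>n\<ge>M. dist (\<Sum>i<m. f i) (\<Sum>i<n. f i) < e"
      by blast
  qed
  then show ?thesis
    unfolding sums_def using Cauchy_convergent convergent_def by blast
qed

text \<open>Bounds on finite blocks of terms survive in the limit: replacing \<open>s\<close> by a
  late partial sum costs an arbitrarily small \<open>e\<close>.\<close>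

lemma sums_tail_le:
  assumes s: "f sums s" and B: "B \<ge> 0" and le: "\<And>i. i \<ge> K \<Longrightarrow> N (f i) \<le> B"
  shows "N (s - (\<Sum>i<K. f i)) \<le> B"
proof (rule field_le_epsilon)
  fix e :: real assume "e > 0"
  then obtain M where M: "\<And>n. n \<ge> M \<Longrightarrow> dist (\<Sum>i<n. f i) s < e"
    using metric_LIMSEQ_D[OF s[unfolded sums_def]] by blast
  define n where "n = max M K"
  have "N (s - (\<Sum>i<K. f i)) = N ((s - (\<Sum>i<n. f i)) + ((\<Sum>i<n. f i) - (\<Sum>i<K. f i)))"
    by simp
  also have "\<dots> \<le> max (N (s - (\<Sum>i<n. f i))) (N ((\<Sum>i<n. f i) - (\<Sum>i<K. f i)))"
    by (rule N_add)
  also have "\<dots> \<le> B + e"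
  proof -
    have "N (s - (\<Sum>i<n. f i)) < e"
      using M[of n] by (simp add: n_def dist_commute flip: dist_eq)
    moreover have "N ((\<Sum>i<n. f i) - (\<Sum>i<K. f i)) \<le> B"
      using B le by (intro N_sum_diff_le[where K = K]) (auto simp: n_def)
    ultimately show ?thesis using B \<open>e > 0\<close> by simp
  qed
  finally show "N (s - (\<Sum>i<K. f i)) \<le> B + e" .
qed

text \<open>
  The new coefficients are the column sums \<open>b k = (\<Sum>n. a n * M n k)\<close>. The difference of the two
  \<open>K\<close>-th partial sums only involves the tails of these column sums, so it is bounded by
  the supremum of the \<open>N (a n)\<close> with \<open>n \<ge> K\<close>.
\<close>

lemma triangular_change:
  fixes M :: "nat \<Rightarrow> nat \<Rightarrow> 'c" and P Q :: "nat \<Rightarrow> 'x \<Rightarrow> 'c"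
  assumes a: "a \<longlonglongrightarrow> 0"
    and M_le: "\<And>n k. N (M n k) \<le> 1"
    and M_tri: "\<And>n k. n < k \<Longrightarrow> M n k = 0"
    and Q_le: "\<And>k t. t \<in> S \<Longrightarrow> N (Q k t) \<le> 1"
    and P_eq: "\<And>n t. t \<in> S \<Longrightarrow> P n t = (\<Sum>k\<le>n. M n k * Q k t)"
    and sums: "\<And>t. t \<in> S \<Longrightarrow> (\<lambda>n. a n * P n t) sums u t"
  shows "\<exists>b. b \<longlonglongrightarrow> 0 \<and> (\<forall>t\<in>S. (\<lambda>k. b k * Q k t) sums u t)"
proof -
  have aM: "N (a n * M n k) \<le> N (a n)" for n k
    using mult_left_mono[OF M_le N_nonneg] by (simp add: N_mult)
  have "(\<lambda>n. a n * M n k) \<longlonglongrightarrow> 0" for k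
  proof -
    have "(\<lambda>n. N (a n * M n k)) \<longlonglongrightarrow> 0"
      by (rule tendsto_sandwich[OF _ _ tendsto_const tendsto_zero_iff[THEN iffD1, OF a]])
        (simp_all add: aM)
    then show ?thesis by (rule tendsto_zero_iff[THEN iffD2])
  qed
  then have "\<forall>k. \<exists>s. (\<lambda>n. a n * M n k) sums s"
    using sums_ex by blast
  then obtain b where b: "\<And>k. (\<lambda>n. a n * M n k) sums b k"
    by metis
  have tail: "N (b k - (\<Sum>n<K. a n * M n k)) \<le> e"
    if "e > 0" "\<And>n. n \<ge> K \<Longrightarrow> N (a n) \<le> e" for e k K
    using that(1) order_trans[OF aM that(2)] by (intro sums_tail_le[OF b]) auto
  have b_le: "N (b k) \<le> e" if "e > 0" "\<And>n. n \<ge> K \<Longrightarrow> N (a n) \<le> e" "k \<ge> K" for e k K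
  proof -
    \<comment> \<open>Cutting column \<open>k\<close> at row \<open>k\<close> instead of
      \<open>K\<close> makes the subtracted sum vanish by triangularity, so all of
      \<open>b k\<close> is a tail.\<close>
    have "N (b k - (\<Sum>n<k. a n * M n k)) \<le> e"
      by (rule tail) (use that in auto)
    then show ?thesis by (simp add: M_tri)
  qed
  have "b \<longlonglongrightarrow> 0"
  proof (rule metric_LIMSEQ_I)
    fix e :: real assume "e > 0"
    then obtain K where "\<And>n. n \<ge> K \<Longrightarrow> N (a n) \<le> e / 2"
      using null_seqD[OF a, of "e / 2"] by auto
    then have "N (b k) \<le> e / 2" if "k \<ge> K" for k
      using \<open>e > 0\<close> that by (intro b_le[of "e / 2" K]) auto
    moreover have "e / 2 < e"
      using \<open>e > 0\<close> by simp
    ultimately have "dist (b k) 0 < e" if "k \<ge> K" for k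
      using that unfolding dist_eq diff_zero by (meson order_le_less_trans)
    then show "\<exists>K. \<forall>k\<ge>K. dist (b k) 0 < e"
      by blast
  qed
  moreover have "(\<lambda>k. b k * Q k t) sums u t" if t: "t \<in> S" for t
    unfolding sums_def
  proof (rule metric_LIMSEQ_I)
    fix e :: real assume "e > 0"
    then obtain K where K: "\<And>n. n \<ge> K \<Longrightarrow> N (a n) \<le> e / 2"
      using null_seqD[OF a, of "e / 2"] by auto
    obtain L where L: "\<And>n. n \<ge> L \<Longrightarrow> dist (\<Sum>i<n. a i * P i t) (u t) < e"
      using metric_LIMSEQ_D[OF sums[OF t, unfolded sums_def] \<open>e > 0\<close>] by blast
    have "dist (\<Sum>k<m. b k * Q k t) (u t) < e" if m: "m \<ge> max K L" for m
    proof -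
      \<comment> \<open>Padding each row with zeros up to \<open>m\<close> makes the double sum
        square, so the order of summation can be exchanged.\<close>
      have P: "P n t = (\<Sum>k<m. M n k * Q k t)" if "n < m" for n
      proof -
        have "(\<Sum>k\<le>n. M n k * Q k t) = (\<Sum>k<m. M n k * Q k t)"
          by (rule sum.mono_neutral_left) (use that M_tri in auto)
        then show ?thesis using P_eq[OF t] by simp
      qed
      have "(\<Sum>i<m. a i * P i t) = (\<Sum>i<m. \<Sum>k<m. a i * M i k * Q k t)"
        by (rule sum.cong) (simp_all add: P sum_distrib_left mult.assoc)
      also have "\<dots> = (\<Sum>k<m. (\<Sum>i<m. a i * M i k) * Q k t)"
        by (subst sum.swap) (simp add: sum_distrib_right)
      finally have eq: "(\<Sum>k<m. b k * Q k t) - (\<Sum>i<m. a i * P i t)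
          = (\<Sum>k<m. (b k - (\<Sum>i<m. a i * M i k)) * Q k t)"
        by (simp add: sum_subtractf left_diff_distrib)
      have summand: "N ((b k - (\<Sum>i<m. a i * M i k)) * Q k t) \<le> e / 2" for k
      proof -
        have "N (b k - (\<Sum>i<m. a i * M i k)) \<le> e / 2"
          by (rule tail) (use K m \<open>e > 0\<close> in auto)
        then have "N (b k - (\<Sum>i<m. a i * M i k)) * N (Q k t) \<le> e / 2 * 1"
          using Q_le[OF t] \<open>e > 0\<close> by (intro mult_mono) auto
        then show ?thesis by (simp add: N_mult)
      qed
      have "N ((\<Sum>k<m. b k * Q k t) - (\<Sum>i<m. a i * P i t)) \<le> e / 2"
        unfolding eq using summand \<open>e > 0\<close> by (intro N_sum_le) auto
      moreover have "N ((\<Sum>i<m. a i * P i t) - u t) < e"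
        using L[of m] m by (simp flip: dist_eq)
      ultimately show ?thesis
        unfolding dist_eq
        using N_add[of "(\<Sum>k<m. b k * Q k t) - (\<Sum>i<m. a i * P i t)" "(\<Sum>i<m. a i * P i t) - u t"]
          \<open>e > 0\<close> by auto
    qed
    then show "\<exists>K. \<forall>m\<ge>K. dist (\<Sum>k<m. b k * Q k t) (u t) < e"
      by blast
  qed
  ultimately show ?thesis by blast
qed

end

section \<open>The Frobenius map\<close>

text \<open>Multiplication by a nonzero \<open>x\<close> permutes the nonzero elements; cancelling
  their product gives \<open>x ^ (q - 1) = 1\<close>.\<close>

lemma finite_field_pow_card:
  fixes x :: "'a::{finite,field}"
  shows "x ^ CARD('a) = x"
proof (cases "x = 0")
  case False
  have "(\<Prod>y\<in>UNIV - {0}. x * y) = (\<Prod>y\<in>UNIV - {0}. y)"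
    by (rule prod.reindex_bij_witness[of _ "\<lambda>y. y / x" "\<lambda>y. x * y"]) (use False in auto)
  then have "x ^ (CARD('a) - 1) = 1"
    by (simp add: prod.distrib card_Diff_singleton)
  moreover have "CARD('a) = Suc (CARD('a) - 1)"
    using finite_UNIV_card_ge_0[where 'a = 'a] by simp
  ultimately show ?thesis by (metis power_Suc mult.right_neutral)
qed simp

lemma card_field_gt_1: "CARD('a::{finite,field}) > 1"
  using card_mono[of UNIV "{0::'a, 1}"] by simp

lemma card_range_fls_const: "card (range (fls_const :: 'a::{finite,field} \<Rightarrow> _)) = CARD('a)"
  by (intro card_image injI) (metis fls_const_nth)

text \<open>As polynomials in \<open>y\<close>, both sides are monic of degree \<open>q\<close> and
  vanish at the \<open>q\<close> constants, hence coincide.\<close>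

lemma prod_diff_const:
  fixes y :: "'a::{finite,field} fls"
  shows "(\<Prod>\<alpha>\<in>UNIV. y - fls_const \<alpha>) = y ^ CARD('a) - y"
proof -
  let ?q = "CARD('a)"
  let ?S = "range (fls_const :: 'a \<Rightarrow> _)"
  define p :: "'a fls poly" where "p = (\<Prod>\<alpha>\<in>UNIV. [:- fls_const \<alpha>, 1:])"
  have poly_p: "poly p z = (\<Prod>\<alpha>\<in>UNIV. z - fls_const \<alpha>)" for z
    by (simp add: p_def poly_prod)
  have deg: "Polynomial.degree p = ?q"
    unfolding p_def by (subst degree_prod_eq_sum_degree) auto
  have lead: "Polynomial.lead_coeff p = 1"
    unfolding p_def by (subst lead_coeff_prod) auto
  have q: "?q > 1" by (rule card_field_gt_1)
  have "p = Polynomial.monom 1 ?q - Polynomial.monom 1 1"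
  proof (rule poly_eqI_degree_lead_coeff[of _ ?q _ ?S])
    show "poly.coeff p ?q = poly.coeff (Polynomial.monom 1 ?q - Polynomial.monom 1 1) ?q"
      using lead deg q by (simp add: coeff_monom)
    show "Polynomial.degree (Polynomial.monom (1 :: 'a fls) ?q - Polynomial.monom 1 1) \<le> ?q"
      using q by (intro degree_diff_le degree_monom_le[THEN order_trans]) auto
  next
    fix z :: "'a fls" assume "z \<in> ?S"
    then obtain \<beta> where z: "z = fls_const \<beta>" by auto
    have "poly p z = 0"
      unfolding poly_p by (rule prod_zero) (use z in auto)
    moreover have "z ^ ?q = z"
      by (simp add: z finite_field_pow_card flip: fls_const_power)
    ultimately show "poly p z = poly (Polynomial.monom 1 ?q - Polynomial.monom 1 1) z"
      by (simp add: poly_monom)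
  qed (simp_all add: deg card_range_fls_const)
  then show ?thesis
    by (simp add: poly_monom flip: poly_p)
qed

text \<open>
  For constant \<open>x\<close> additivity is the translation invariance of the product in
  \<open>prod_diff_const\<close>; \<open>(x + y)\<^sup>q\<close> and \<open>x\<^sup>q + y\<^sup>q\<close> are then monic polynomials
  in \<open>x\<close> of degree \<open>q\<close> that agree at \<open>q\<close> points.
\<close>

lemma frobenius_add:
  fixes x y :: "'a::{finite,field} fls"
  shows "(x + y) ^ CARD('a) = x ^ CARD('a) + y ^ CARD('a)"
proof -
  let ?q = "CARD('a)"
  let ?S = "range (fls_const :: 'a \<Rightarrow> _)"
  have const: "(y + fls_const \<beta>) ^ ?q = y ^ ?q + fls_const \<beta>" for \<beta> :: 'a
  proof -
    have "(\<Prod>\<alpha>\<in>UNIV. y + fls_const \<beta> - fls_const \<alpha>) = (\<Prod>\<alpha>\<in>UNIV. y - fls_const \<alpha>)"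
      by (rule prod.reindex_bij_witness[of _ "\<lambda>\<alpha>. \<alpha> + \<beta>" "\<lambda>\<alpha>. \<alpha> - \<beta>"])
        (simp_all flip: fls_minus_const)
    then show ?thesis
      by (simp add: prod_diff_const algebra_simps)
  qed
  have q: "?q > 1" by (rule card_field_gt_1)
  have deg: "Polynomial.degree ([:y, 1:] ^ ?q) = ?q"
    by (simp add: degree_power_eq)
  have lead: "Polynomial.lead_coeff ([:y, 1:] ^ ?q) = 1"
    by (subst lead_coeff_power) simp
  have "[:y, 1:] ^ ?q = Polynomial.monom 1 ?q + [:y ^ ?q:]"
  proof (rule poly_eqI_degree_lead_coeff[of _ ?q _ ?S])
    have "poly.coeff [:y ^ ?q:] ?q = 0"
      using q by (intro coeff_eq_0) simp
    then show "poly.coeff ([:y, 1:] ^ ?q) ?q = poly.coeff (Polynomial.monom 1 ?q + [:y ^ ?q:]) ?q"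
      using lead unfolding deg by simp
    show "Polynomial.degree (Polynomial.monom 1 ?q + [:y ^ ?q:]) \<le> ?q"
      by (intro degree_add_le degree_monom_le) auto
  next
    fix z :: "'a fls" assume "z \<in> ?S"
    then obtain \<beta> where z: "z = fls_const \<beta>" by auto
    have "z ^ ?q = z"
      by (simp add: z finite_field_pow_card flip: fls_const_power)
    then show "poly ([:y, 1:] ^ ?q) z = poly (Polynomial.monom 1 ?q + [:y ^ ?q:]) z"
      using const[of \<beta>] by (simp add: poly_monom z)
  qed (simp_all add: deg card_range_fls_const)
  then have "poly ([:y, 1:] ^ ?q) x = poly (Polynomial.monom 1 ?q + [:y ^ ?q:]) x"
    by simp
  then show ?thesis
    by (simp add: poly_monom add.commute)
qed

lemma frobenius_sum:
  fixes f :: "'b \<Rightarrow> 'a::{finite,field} fls"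
  shows "(\<Sum>i\<in>A. f i) ^ CARD('a) = (\<Sum>i\<in>A. f i ^ CARD('a))"
  by (induction A rule: infinite_finite_induct) (auto simp: frobenius_add)

text \<open>Homogeneous form of \<open>prod_diff_const\<close>, obtained by taking \<open>y\<close>
  out of every factor. For \<open>y = 0\<close> both sides are \<open>x ^ q\<close>, because
  \<open>q > 1\<close>.\<close>

lemma prod_diff_const_mult:
  fixes x y :: "'a::{finite,field} fls"
  shows "(\<Prod>\<alpha>\<in>UNIV. x - fls_const \<alpha> * y) = x ^ CARD('a) - y ^ (CARD('a) - 1) * x"
proof (cases "y = 0")
  case True
  then show ?thesis using card_field_gt_1[where 'a = 'a] by (simp add: power_0_left)
next
  case False
  let ?q = "CARD('a)"
  have "(\<Prod>\<alpha>\<in>UNIV. x - fls_const \<alpha> * y) = (\<Prod>\<alpha>\<in>UNIV. y * (x / y - fls_const \<alpha>))"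
    using False by (simp add: algebra_simps)
  also have "\<dots> = y ^ ?q * ((x / y) ^ ?q - x / y)"
    by (simp add: prod.distrib prod_diff_const)
  also have "\<dots> = x ^ ?q - (y ^ ?q / y) * x"
    using False by (simp add: right_diff_distrib power_divide)
  also have "y ^ ?q / y = y ^ (?q - 1)"
    using False card_field_gt_1[where 'a = 'a] by (cases ?q) auto
  finally show ?thesis .
qed

section \<open>Carlitz polynomials\<close>

abbreviation poly_to_fls :: "'a::{finite,field} poly \<Rightarrow> 'a fls" where
  "poly_to_fls m \<equiv> fps_to_fls (fps_of_poly m)"

text \<open>Unlike \<open>degree m < n\<close>, this correctly gives \<open>{0}\<close> for \<open>n = 0\<close>.\<close>

definition polys_below :: "nat \<Rightarrow> 'a::{finite,field} poly set" where
  "polys_below n = {m. \<forall>k\<ge>n. Polynomial.coeff m k = 0}"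

lemma polys_below_0: "polys_below 0 = {0}"
  by (auto simp: polys_below_def poly_eq_iff)

lemma polys_below_pos:
  assumes "n > 0"
  shows "polys_below n = {m :: 'a::{finite,field} poly. Polynomial.degree m < n}"
  using assms by (auto simp: polys_below_def coeff_eq_0 intro!: degree_lessI)

text \<open>Splitting off the coefficient of \<open>x ^ n\<close> regroups the roots of
  \<open>carlitz_e (Suc n)\<close> into \<open>q\<close> translates of those of
  \<open>carlitz_e n\<close>.\<close>

lemma polys_below_Suc:
  "bij_betw (\<lambda>(\<alpha>, m). m + Polynomial.monom \<alpha> n) (UNIV \<times> polys_below n)
     (polys_below (Suc n) :: 'a::{finite,field} poly set)"
proof (rule bij_betwI[of _ _ _ "\<lambda>m. (Polynomial.coeff m n, m - Polynomial.monom (Polynomial.coeff m n) n)"])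
  show "(\<lambda>m. (Polynomial.coeff m n, m - Polynomial.monom (Polynomial.coeff m n) n)) \<in> polys_below (Suc n) \<rightarrow> UNIV \<times> polys_below n"
    by (auto simp: polys_below_def coeff_monom)
qed (auto simp: polys_below_def coeff_monom)

lemma finite_polys_below [simp]: "finite (polys_below n :: 'a::{finite,field} poly set)"
proof (induction n)
  case (Suc n)
  then show ?case
    using bij_betw_finite[OF polys_below_Suc[where 'a = 'a, of n]] by simp
qed (simp add: polys_below_0)

lemma carlitz_e_eq_prod: "carlitz_e n t = (\<Prod>m\<in>polys_below n. t - poly_to_fls m)"
  by (simp add: carlitz_e_def polys_below_0 polys_below_pos)

lemma poly_to_fls_add_monom:
  "poly_to_fls (m + Polynomial.monom \<alpha> n) = poly_to_fls m + fls_const \<alpha> * fls_X ^ n"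
  by (simp add: fps_of_poly_add fps_of_poly_monom fls_times_fps_to_fls fps_to_fls_power)

section \<open>Recurrence and linearity of the Carlitz polynomials\<close>

lemma carlitz_e_Suc_prod:
  "carlitz_e (Suc n) t = (\<Prod>\<alpha>\<in>UNIV. carlitz_e n (t - fls_const \<alpha> * fls_X ^ n))"
proof -
  have "carlitz_e (Suc n) t
      = (\<Prod>(\<alpha>, m)\<in>UNIV \<times> polys_below n. t - poly_to_fls (m + Polynomial.monom \<alpha> n))"
    unfolding carlitz_e_eq_prod
    by (subst prod.reindex_bij_betw[OF polys_below_Suc, symmetric]) (simp add: case_prod_unfold)
  also have "\<dots> = (\<Prod>\<alpha>\<in>UNIV. \<Prod>m\<in>polys_below n. t - poly_to_fls (m + Polynomial.monom \<alpha> n))"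
    by (simp add: prod.cartesian_product)
  finally show ?thesis
    by (simp only: carlitz_e_eq_prod poly_to_fls_add_monom) (simp add: algebra_simps)
qed

text \<open>Classically \<open>carlitz_e n (fls_X ^ n)\<close> is the product of all monic
  polynomials of degree \<open>n\<close>, that is, \<open>carlitz_D n\<close>.\<close>

abbreviation carlitz_d :: "nat \<Rightarrow> 'a::{finite,field} fls" where
  "carlitz_d n \<equiv> carlitz_e n (fls_X ^ n) ^ (CARD('a) - 1)"

text \<open>Linearity at \<open>n\<close> yields the recurrence at \<open>n\<close>, which in turn
  yields linearity at \<open>n + 1\<close>. Taking linearity as a hypothesis lets the induction in
  \<open>carlitz_e_linear\<close> alternate between the two.\<close>

lemma carlitz_e_recurrence:
  fixes t :: "'a::{finite,field} fls"
  assumes "\<And>(s::'a fls) \<alpha> r. carlitz_e n (s - fls_const \<alpha> * r) = carlitz_e n s - fls_const \<alpha> * carlitz_e n r"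
  shows "carlitz_e (Suc n) t = carlitz_e n t ^ CARD('a) - carlitz_d n * carlitz_e n t"
  unfolding carlitz_e_Suc_prod assms by (rule prod_diff_const_mult)

lemma carlitz_e_linear:
  fixes s r :: "'a::{finite,field} fls"
  shows "carlitz_e n (s - fls_const \<alpha> * r) = carlitz_e n s - fls_const \<alpha> * carlitz_e n r"
proof (induction n arbitrary: s \<alpha> r)
  case 0
  show ?case by (simp add: carlitz_e_def)
next
  case (Suc n)
  let ?q = "CARD('a)"
  \<comment> \<open>The \<open>q\<close>-th power is additive and fixes the constants, so the right
    side of the recurrence is linear whenever \<open>carlitz_e n\<close> is.\<close>
  have frobenius: "(a - fls_const \<alpha> * b) ^ ?q = a ^ ?q - fls_const \<alpha> * b ^ ?q" for a b :: "'a fls"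
  proof -
    have "(a - fls_const \<alpha> * b) ^ ?q + (fls_const \<alpha> * b) ^ ?q = a ^ ?q"
      by (subst frobenius_add[symmetric]) simp
    then show ?thesis
      by (simp add: power_mult_distrib eq_diff_eq finite_field_pow_card flip: fls_const_power)
  qed
  then show ?case
    unfolding carlitz_e_recurrence[OF Suc.IH] Suc.IH frobenius by (simp add: algebra_simps)
qed

lemma carlitz_e_Suc:
  fixes t :: "'a::{finite,field} fls"
  shows "carlitz_e (Suc n) t = carlitz_e n t ^ CARD('a) - carlitz_d n * carlitz_e n t"
  by (rule carlitz_e_recurrence[OF carlitz_e_linear])

text \<open>For \<open>m < n\<close> the polynomial \<open>x ^ m\<close> is itself one of the roots
  in the product.\<close>

lemma carlitz_e_X_power_eq_0:
  assumes "m < n"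
  shows "carlitz_e n (fls_X ^ m :: 'a::{finite,field} fls) = 0"
  unfolding carlitz_e_eq_prod
proof (rule prod_zero)
  show "\<exists>p\<in>polys_below n. fls_X ^ m - poly_to_fls p = (0 :: 'a fls)"
    using assms poly_to_fls_add_monom[of 0 "1 :: 'a" m]
    by (intro bexI[of _ "Polynomial.monom 1 m"]) (auto simp: polys_below_def coeff_monom)
qed simp

text \<open>A vanishing factor would make \<open>x ^ n\<close> a polynomial without a term of degree
  \<open>n\<close>.\<close>

lemma carlitz_e_X_power_neq_0: "carlitz_e n (fls_X ^ n :: 'a::{finite,field} fls) \<noteq> 0"
  unfolding carlitz_e_eq_prod
proof (subst prod_zero_iff; safe?)
  fix p :: "'a poly" assume p: "p \<in> polys_below n" "fls_X ^ n - poly_to_fls p = 0"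
  have "fls_X ^ n = poly_to_fls (Polynomial.monom (1 :: 'a) n)"
    using poly_to_fls_add_monom[of 0 "1 :: 'a" n] by simp
  with p(2) have "p = Polynomial.monom 1 n"
    by (simp add: fps_of_poly_eq_iff del: fls_X_power_conv_shift_1)
  with p(1) have "poly.coeff (Polynomial.monom (1 :: 'a) n) n = 0"
    unfolding polys_below_def by blast
  then show False by simp
qed simp

section \<open>Integrality\<close>

lemma power_int_le_1_iff:
  fixes b :: real
  assumes "b > 1"
  shows "b powi n \<le> 1 \<longleftrightarrow> n \<le> 0"
proof
  assume "b powi n \<le> 1"
  then have "b powi n \<le> b powi 0" by simp
  then show "n \<le> 0" using power_int_le_imp_le_exp[OF assms] by blast
next
  assume "n \<le> 0"
  then have "b powi n \<le> b powi 0"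
    using assms by (intro power_int_increasing) auto
  then show "b powi n \<le> 1" by simp
qed

lemma laurent_integers_iff_subdegree:
  fixes z :: "'a::{finite,field} fls"
  shows "z \<in> laurent_integers \<longleftrightarrow> fls_subdegree z \<ge> 0"
proof (cases "z = 0")
  case False
  have "real CARD('a) > 1"
    using card_field_gt_1[where 'a = 'a] by simp
  from power_int_le_1_iff[OF this, of "- fls_subdegree z"] False show ?thesis
    unfolding laurent_integers_def laurent_abs_def by simp
qed (simp add: laurent_integers_def laurent_abs_def)

text \<open>Viewing \<open>O\<close> as the image of the power series ring makes its closure under
  ring operations immediate.\<close>

lemma laurent_integers_eq: "laurent_integers = range (fps_to_fls :: 'a::{finite,field} fps \<Rightarrow> _)"
proof (intro equalityI subsetI)
  fix z :: "'a fls" assume "z \<in> laurent_integers"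
  then have "fps_to_fls (fls_regpart z) = z"
    by (intro fls_regpart_to_fls_trivial) (simp only: laurent_integers_iff_subdegree)
  then show "z \<in> range fps_to_fls"
    by (metis rangeI)
next
  fix z :: "'a fls" assume "z \<in> range fps_to_fls"
  then show "z \<in> laurent_integers"
    unfolding laurent_integers_iff_subdegree by (metis fls_subdegree_fls_to_fps_gt0 rangeE)
qed

lemma laurent_integers_0 [simp]: "0 \<in> laurent_integers"
  and laurent_integers_1 [simp]: "1 \<in> laurent_integers"
  by (simp_all add: laurent_integers_iff_subdegree)

lemma laurent_integers_add: "a \<in> laurent_integers \<Longrightarrow> b \<in> laurent_integers \<Longrightarrow> a + b \<in> laurent_integers"
  unfolding laurent_integers_eq by (elim rangeE) (simp only: rangeI flip: fps_to_fls_plus)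

lemma laurent_integers_diff: "a \<in> laurent_integers \<Longrightarrow> b \<in> laurent_integers \<Longrightarrow> a - b \<in> laurent_integers"
  unfolding laurent_integers_eq by (elim rangeE) (simp only: rangeI flip: fps_to_fls_minus)

lemma laurent_integers_mult: "a \<in> laurent_integers \<Longrightarrow> b \<in> laurent_integers \<Longrightarrow> a * b \<in> laurent_integers"
  unfolding laurent_integers_eq by (elim rangeE) (simp only: rangeI flip: fls_times_fps_to_fls)

lemma laurent_integers_power: "a \<in> laurent_integers \<Longrightarrow> a ^ n \<in> laurent_integers"
  by (induction n) (auto intro: laurent_integers_mult)

lemma fls_X_power_integer: "fls_X ^ n \<in> laurent_integers"
proof (rule laurent_integers_power)
  show "fls_X \<in> laurent_integers"
    by (simp add: laurent_integers_iff_subdegree)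
qed

lemma carlitz_e_integer: "t \<in> laurent_integers \<Longrightarrow> carlitz_e n t \<in> laurent_integers"
proof (induction n arbitrary: t)
  case 0
  then show ?case by (simp add: carlitz_e_def)
next
  case (Suc n)
  \<comment> \<open>The induction hypothesis is used at \<open>t\<close> and also at
    \<open>x ^ n\<close>, the latter for the coefficient \<open>carlitz_d n\<close>.\<close>
  show ?case
    unfolding carlitz_e_Suc
    by (intro laurent_integers_diff laurent_integers_mult laurent_integers_power Suc
        fls_X_power_integer)
qed

text \<open>
  Both recursions for the coefficients come from \<open>carlitz_e_Suc\<close> and the additivity of the
  \<open>q\<close>-th power: one for \<open>carlitz_e n t\<close> in terms of the \<open>t ^ (q ^ k)\<close>, the other for the inverse.
\<close>

fun carlitz_coeff :: "nat \<Rightarrow> nat \<Rightarrow> 'a::{finite,field} fls" where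
  "carlitz_coeff 0 k = (if k = 0 then 1 else 0)"
| "carlitz_coeff (Suc n) k =
     (case k of 0 \<Rightarrow> 0 | Suc k' \<Rightarrow> carlitz_coeff n k' ^ CARD('a)) - carlitz_d n * carlitz_coeff n k"

fun carlitz_inv_coeff :: "nat \<Rightarrow> nat \<Rightarrow> 'a::{finite,field} fls" where
  "carlitz_inv_coeff 0 k = (if k = 0 then 1 else 0)"
| "carlitz_inv_coeff (Suc n) k =
     (case k of 0 \<Rightarrow> 0 | Suc k' \<Rightarrow> carlitz_inv_coeff n k' ^ CARD('a))
     + carlitz_d k * carlitz_inv_coeff n k ^ CARD('a)"

lemma carlitz_coeff_eq_0: "n < k \<Longrightarrow> carlitz_coeff n k = (0 :: 'a::{finite,field} fls)"
  by (induction n arbitrary: k) (auto split: nat.splits)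

lemma carlitz_inv_coeff_eq_0: "n < k \<Longrightarrow> carlitz_inv_coeff n k = (0 :: 'a::{finite,field} fls)"
  by (induction n arbitrary: k) (auto split: nat.splits simp: power_0_left)

lemma carlitz_d_integer: "carlitz_d n \<in> laurent_integers"
  by (intro laurent_integers_power carlitz_e_integer fls_X_power_integer)

lemma carlitz_coeff_integer: "carlitz_coeff n k \<in> (laurent_integers :: 'a::{finite,field} fls set)"
proof (induction n arbitrary: k)
  case (Suc n)
  have "(case k of 0 \<Rightarrow> 0 | Suc k' \<Rightarrow> carlitz_coeff n k' ^ CARD('a))
      \<in> (laurent_integers :: 'a fls set)"
    by (simp add: Suc.IH laurent_integers_power split: nat.split)
  then show ?case
    unfolding carlitz_coeff.simps
    by (intro laurent_integers_diff laurent_integers_mult carlitz_d_integer Suc.IH)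
qed simp

lemma carlitz_inv_coeff_integer:
  "carlitz_inv_coeff n k \<in> (laurent_integers :: 'a::{finite,field} fls set)"
proof (induction n arbitrary: k)
  case (Suc n)
  have "(case k of 0 \<Rightarrow> 0 | Suc k' \<Rightarrow> carlitz_inv_coeff n k' ^ CARD('a))
      \<in> (laurent_integers :: 'a fls set)"
    by (simp add: Suc.IH laurent_integers_power split: nat.split)
  then show ?case
    unfolding carlitz_inv_coeff.simps
    by (intro laurent_integers_add laurent_integers_mult laurent_integers_power
        carlitz_d_integer Suc.IH)
qed simp

lemma power_power_Suc: "t ^ (q ^ Suc k) = (t ^ (q ^ k)) ^ q"
  for t :: "'b::monoid_mult" and q :: nat
  by (simp only: power_Suc2 power_mult)

lemma carlitz_e_eq_sum:
  fixes t :: "'a::{finite,field} fls"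
  shows "carlitz_e n t = (\<Sum>k\<le>n. carlitz_coeff n k * t ^ (CARD('a) ^ k))"
proof (induction n)
  case 0
  show ?case by (simp add: carlitz_e_def)
next
  case (Suc n)
  let ?q = "CARD('a)"
  let ?s = "\<lambda>k. (case k of 0 \<Rightarrow> 0 | Suc k' \<Rightarrow> carlitz_coeff n k' ^ ?q) :: 'a fls"
  \<comment> \<open>The \<open>q\<close>-th power moves the term with index \<open>k\<close> to
    index \<open>k + 1\<close>; the value \<open>0\<close> of \<open>?s\<close> at \<open>0\<close>
    fills the gap.\<close>
  have "(\<Sum>k\<le>Suc n. ?s k * t ^ (?q ^ k)) = (\<Sum>k\<le>n. (carlitz_coeff n k * t ^ (?q ^ k)) ^ ?q)"
    by (subst sum.atMost_Suc_shift)
      (simp add: power_mult_distrib power_power_Suc del: power_Suc)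
  also have "\<dots> = carlitz_e n t ^ ?q"
    by (simp add: Suc.IH frobenius_sum)
  finally have 1: "(\<Sum>k\<le>Suc n. ?s k * t ^ (?q ^ k)) = carlitz_e n t ^ ?q" .
  \<comment> \<open>Raising the upper limit to \<open>Suc n\<close> is harmless, since the
    coefficient above the diagonal is \<open>0\<close>.\<close>
  have 2: "(\<Sum>k\<le>Suc n. carlitz_d n * carlitz_coeff n k * t ^ (?q ^ k)) = carlitz_d n * carlitz_e n t"
    by (simp add: Suc.IH carlitz_coeff_eq_0 sum_distrib_left mult.assoc)
  have "(\<Sum>k\<le>Suc n. carlitz_coeff (Suc n) k * t ^ (?q ^ k))
      = (\<Sum>k\<le>Suc n. ?s k * t ^ (?q ^ k)) - (\<Sum>k\<le>Suc n. carlitz_d n * carlitz_coeff n k * t ^ (?q ^ k))"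
    by (simp only: carlitz_coeff.simps left_diff_distrib sum_subtractf)
  then show ?case unfolding 1 2 carlitz_e_Suc by simp
qed

lemma power_eq_sum_carlitz_e:
  fixes t :: "'a::{finite,field} fls"
  shows "t ^ (CARD('a) ^ n) = (\<Sum>k\<le>n. carlitz_inv_coeff n k * carlitz_e k t)"
proof (induction n)
  case 0
  show ?case by (simp add: carlitz_e_def)
next
  case (Suc n)
  let ?q = "CARD('a)"
  let ?F = "carlitz_inv_coeff n :: nat \<Rightarrow> 'a fls"
  let ?s = "\<lambda>k. case k of 0 \<Rightarrow> 0 | Suc k' \<Rightarrow> ?F k' ^ ?q"
  have "t ^ (?q ^ Suc n) = (\<Sum>k\<le>n. ?F k * carlitz_e k t) ^ ?q"
    by (simp only: power_power_Suc Suc.IH)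
  also have "\<dots> = (\<Sum>k\<le>n. ?F k ^ ?q * carlitz_e k t ^ ?q)"
    by (simp add: frobenius_sum power_mult_distrib)
  \<comment> \<open>The recurrence is solved for the \<open>q\<close>-th power of
    \<open>carlitz_e k t\<close>.\<close>
  also have "\<dots> = (\<Sum>k\<le>n. ?F k ^ ?q * carlitz_e (Suc k) t)
      + (\<Sum>k\<le>n. carlitz_d k * ?F k ^ ?q * carlitz_e k t)"
    by (simp add: carlitz_e_Suc algebra_simps flip: sum.distrib)
  also have "(\<Sum>k\<le>n. ?F k ^ ?q * carlitz_e (Suc k) t) = (\<Sum>k\<le>Suc n. ?s k * carlitz_e k t)"
    by (subst sum.atMost_Suc_shift) simp
  also have "(\<Sum>k\<le>n. carlitz_d k * ?F k ^ ?q * carlitz_e k t)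
      = (\<Sum>k\<le>Suc n. carlitz_d k * ?F k ^ ?q * carlitz_e k t)"
    by (simp add: carlitz_inv_coeff_eq_0)
  finally show ?case
    by (simp only: carlitz_inv_coeff.simps distrib_right sum.distrib)
qed

section \<open>The absolute value of the Carlitz factorials\<close>

lemma fls_subdegree_prod_nonzero:
  fixes F :: "'b \<Rightarrow> 'c::idom fls"
  assumes "\<And>x. x \<in> A \<Longrightarrow> F x \<noteq> 0"
  shows "fls_subdegree (\<Prod>x\<in>A. F x) = (\<Sum>x\<in>A. fls_subdegree (F x))"
  using assms by (induction A rule: infinite_finite_induct) auto

text \<open>For \<open>i > 0\<close> the exponent \<open>q ^ i\<close> exceeds \<open>1\<close>, so
  the lowest term is \<open>- x\<close>.\<close>

lemma carlitz_bracket_subdegree: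
  assumes "i > 0"
  shows "fls_subdegree (carlitz_bracket i :: 'a::{finite,field} fls) = 1"
    and "carlitz_bracket i \<noteq> (0 :: 'a::{finite,field} fls)"
proof -
  have q: "int CARD('a) ^ i > 1"
    using one_less_power[of "int CARD('a)" i] card_field_gt_1[where 'a = 'a] assms by simp
  have nth: "fls_nth (carlitz_bracket i) 1 = (- 1 :: 'a)"
    using q by (simp add: carlitz_bracket_def)
  show "fls_subdegree (carlitz_bracket i :: 'a fls) = 1"
    using q by (intro fls_subdegree_eqI) (auto simp: carlitz_bracket_def)
  show "carlitz_bracket i \<noteq> (0 :: 'a fls)"
    using nth by auto
qed

lemma carlitz_D_neq_0: "carlitz_D n \<noteq> (0 :: 'a::{finite,field} fls)"
  by (auto simp: carlitz_D_def carlitz_bracket_subdegree)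

text \<open>Every bracket has valuation \<open>1\<close>, so the valuation of
  \<open>carlitz_D n\<close> is the geometric sum of the \<open>q ^ k\<close> with
  \<open>k < n\<close>.\<close>

lemma laurent_abs_carlitz_D:
  "laurent_abs (carlitz_D n :: 'a::{finite,field} fls)
     = real CARD('a) powr ((1 - real CARD('a) ^ n) / (real CARD('a) - 1))"
proof -
  let ?q = "real CARD('a)"
  have q: "?q > 1" using card_field_gt_1[where 'a = 'a] by simp
  have "fls_subdegree (carlitz_D n :: 'a fls) = (\<Sum>k=1..n. int (CARD('a) ^ (n - k)))"
    unfolding carlitz_D_def
    by (subst fls_subdegree_prod_nonzero) (auto simp: carlitz_bracket_subdegree fls_subdegree_pow)
  also have "\<dots> = (\<Sum>k<n. int (CARD('a) ^ k))"
    by (rule sum.reindex_bij_witness[of _ "\<lambda>k. n - k" "\<lambda>k. n - k"]) auto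
  finally have "real_of_int (- fls_subdegree (carlitz_D n :: 'a fls)) = - (\<Sum>k<n. ?q ^ k)"
    by simp
  also have "\<dots> = (1 - ?q ^ n) / (?q - 1)"
    using q by (subst geometric_sum) (auto simp: field_simps)
  finally show ?thesis
    using q carlitz_D_neq_0[of n, where 'a = 'a]
    by (simp add: laurent_abs_def flip: powr_real_of_int')
qed

section \<open>Expansions over the completed algebraic closure\<close>

context completed_alg_closure
begin

sublocale ultrametric_field "\<lambda>z::'c. dist z 0"
  by unfold_locales (fact dist_diff abs_mult ultrametric)+

definition emb :: "'a fls \<Rightarrow> 'c" where
  "emb t = j (to_ac t)"

lemma emb_add: "emb (a + b) = emb a + emb b"
  and emb_mult: "emb (a * b) = emb a * emb b"
  and emb_1 [simp]: "emb 1 = 1"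
  by (simp_all add: emb_def j_add j_mult j_1)

lemma emb_0 [simp]: "emb 0 = 0"
  using emb_add[of 0 0] by (metis add.right_neutral add_left_cancel)

lemma emb_power: "emb (a ^ n) = emb a ^ n"
  by (induction n) (auto simp: emb_mult)

lemma emb_sum: "emb (\<Sum>i\<in>A. f i) = (\<Sum>i\<in>A. emb (f i))"
  by (induction A rule: infinite_finite_induct) (auto simp: emb_add)

lemma dist_emb: "dist (emb t) 0 = laurent_abs t"
  by (simp add: emb_def abs_extends)

lemma dist_emb_le_1: "t \<in> laurent_integers \<Longrightarrow> dist (emb t) 0 \<le> 1"
  by (simp add: dist_emb laurent_integers_def)

lemma emb_eq_0_iff [simp]: "emb t = 0 \<longleftrightarrow> t = 0"
proof -
  have "laurent_abs t = 0 \<longleftrightarrow> t = 0"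
    using card_field_gt_1[where 'a = 'a] by (auto simp: laurent_abs_def)
  then show ?thesis by (metis dist_emb dist_eq_0_iff)
qed

lemma emb_D_mult_f: "emb (carlitz_D n) * emb (carlitz_f n t) = emb (carlitz_e n t)"
  using carlitz_D_neq_0[of n, where 'a = 'a]
  by (simp add: carlitz_f_def mult.assoc[symmetric] flip: emb_mult)

text \<open>Each direction is an instance of \<open>triangular_change\<close>: both transition
  matrices are integral and triangular, and both bases are bounded by \<open>1\<close> on
  \<open>O\<close>.\<close>

lemma A_space_iff:
  "u \<in> A_space j \<longleftrightarrow> (\<exists>b. b \<longlonglongrightarrow> 0 \<and>
     (\<forall>t\<in>laurent_integers. (\<lambda>n. b n * emb (carlitz_e n t)) sums u t))"
proof
  assume "u \<in> A_space j"
  then obtain a where a: "a \<longlonglongrightarrow> 0"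
    "\<And>t. t \<in> laurent_integers \<Longrightarrow> (\<lambda>n. a n * emb t ^ (CARD('a) ^ n)) sums u t"
    by (auto simp: A_space_def emb_def)
  have eq: "emb t ^ (CARD('a) ^ n)
      = (\<Sum>k\<le>n. emb (carlitz_inv_coeff n k) * emb (carlitz_e k t))" for t n
    by (simp only: power_eq_sum_carlitz_e emb_sum emb_mult flip: emb_power)
  show "\<exists>b. b \<longlonglongrightarrow> 0 \<and> (\<forall>t\<in>laurent_integers. (\<lambda>n. b n * emb (carlitz_e n t)) sums u t)"
    by (rule triangular_change[OF a(1) _ _ _ eq a(2)])
      (simp_all add: dist_emb_le_1 carlitz_inv_coeff_integer carlitz_inv_coeff_eq_0
        carlitz_e_integer)
next
  assume "\<exists>b. b \<longlonglongrightarrow> 0 \<and> (\<forall>t\<in>laurent_integers. (\<lambda>n. b n * emb (carlitz_e n t)) sums u t)"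
  then obtain b where b: "b \<longlonglongrightarrow> 0"
    "\<And>t. t \<in> laurent_integers \<Longrightarrow> (\<lambda>n. b n * emb (carlitz_e n t)) sums u t"
    by blast
  have eq: "emb (carlitz_e n t)
      = (\<Sum>k\<le>n. emb (carlitz_coeff n k) * emb t ^ (CARD('a) ^ k))" for t n
    by (simp only: carlitz_e_eq_sum[of n t] emb_sum emb_mult flip: emb_power)
  have "\<exists>a. a \<longlonglongrightarrow> 0 \<and> (\<forall>t\<in>laurent_integers. (\<lambda>n. a n * emb t ^ (CARD('a) ^ n)) sums u t)"
    by (rule triangular_change[OF b(1) _ _ _ eq b(2)])
      (simp_all add: dist_emb_le_1 carlitz_coeff_integer carlitz_coeff_eq_0
        laurent_integers_power flip: emb_power)
  then show "u \<in> A_space j" by (simp add: A_space_def emb_def)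
qed

text \<open>
  Evaluation at \<open>t = x\<^sup>m\<close> makes the expansion finite, with last term \<open>n = m\<close>, so the
  coefficients are determined recursively.
\<close>

lemma carlitz_expansion_unique:
  assumes "\<And>t. t \<in> laurent_integers \<Longrightarrow> (\<lambda>n. c n * emb (carlitz_f n t)) sums u t"
    and "\<And>t. t \<in> laurent_integers \<Longrightarrow> (\<lambda>n. c' n * emb (carlitz_f n t)) sums u t"
  shows "c m = c' m"
proof (induction m rule: less_induct)
  case (less m)
  let ?f = "\<lambda>n. emb (carlitz_f n (fls_X ^ m))"
  have f0: "?f n = 0" if "n > m" for n
    using carlitz_e_X_power_eq_0[OF that, where 'a = 'a] by (simp add: carlitz_f_def)
  have *: "u (fls_X ^ m) = (\<Sum>n<m. d n * ?f n) + d m * ?f m"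
    if "\<And>t. t \<in> laurent_integers \<Longrightarrow> (\<lambda>n. d n * emb (carlitz_f n t)) sums u t" for d
  proof -
    have "(\<lambda>n. d n * ?f n) sums (\<Sum>n\<in>{..m}. d n * ?f n)"
      by (rule sums_finite) (simp_all add: f0 del: emb_eq_0_iff)
    from sums_unique2[OF that[OF fls_X_power_integer] this] show ?thesis
      by (simp flip: lessThan_Suc_atMost)
  qed
  have "(\<Sum>n<m. c n * ?f n) = (\<Sum>n<m. c' n * ?f n)"
    using less.IH by simp
  then have "c m * ?f m = c' m * ?f m"
    using *[OF assms(1)] *[OF assms(2)] by auto
  moreover have "?f m \<noteq> 0"
    using carlitz_e_X_power_neq_0[of m, where 'a = 'a] carlitz_D_neq_0[of m, where 'a = 'a]
    by (simp add: carlitz_f_def)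
  ultimately show ?case by simp
qed

section \<open>From the coefficients \<open>c n\<close> to the growth condition\<close>

lemma carlitz_expansion_sums:
  assumes "carlitz_expansion j u c" "t \<in> laurent_integers"
  shows "(\<lambda>n. c n * emb (carlitz_f n t)) sums u t"
proof -
  have "uniform_limit laurent_integers (\<lambda>N t. \<Sum>n<N. c n * j (to_ac (carlitz_f n t))) u sequentially"
    using assms(1) by (simp only: carlitz_expansion_def)
  from tendsto_uniform_limitI[OF this assms(2)] show ?thesis
    by (simp only: sums_def emb_def)
qed

text \<open>Since \<open>carlitz_e n\<close> is \<open>carlitz_D n\<close> times
  \<open>carlitz_f n\<close>, coefficients \<open>b n\<close> for the former are coefficients
  \<open>b n * emb (carlitz_D n)\<close> for the latter; uniqueness identifies these with
  \<open>c n\<close>.\<close>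

lemma A_space_iff_coeffs:
  assumes "carlitz_expansion j u c"
  shows "u \<in> A_space j \<longleftrightarrow> (\<lambda>n. c n / emb (carlitz_D n)) \<longlonglongrightarrow> 0"
proof
  have D: "emb (carlitz_D n) \<noteq> 0" for n
    by (simp add: carlitz_D_neq_0)
  note c = carlitz_expansion_sums[OF assms]
  {
    assume "u \<in> A_space j"
    then obtain b where b: "b \<longlonglongrightarrow> 0"
      "\<And>t. t \<in> laurent_integers \<Longrightarrow> (\<lambda>n. b n * emb (carlitz_e n t)) sums u t"
      unfolding A_space_iff by blast
    have b': "(\<lambda>n. b n * emb (carlitz_D n) * emb (carlitz_f n t)) sums u t"
      if "t \<in> laurent_integers" for t
      using b(2)[OF that] by (simp add: emb_D_mult_f mult.assoc)
    have "c n = b n * emb (carlitz_D n)" for n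
      by (rule carlitz_expansion_unique[where u = u and c = c
            and c' = "\<lambda>n. b n * emb (carlitz_D n)"]) (fact c, fact b')
    then have "c n / emb (carlitz_D n) = b n" for n
      using D by simp
    with b(1) show "(\<lambda>n. c n / emb (carlitz_D n)) \<longlonglongrightarrow> 0" by (simp only:)
  }
  assume "(\<lambda>n. c n / emb (carlitz_D n)) \<longlonglongrightarrow> 0"
  moreover have "c n / emb (carlitz_D n) * emb (carlitz_e n t) = c n * emb (carlitz_f n t)" for n t
    using D by (simp flip: emb_D_mult_f)
  ultimately show "u \<in> A_space j"
    unfolding A_space_iff
    by (intro exI[of _ "\<lambda>n. c n / emb (carlitz_D n)"] conjI ballI) (simp_all only: c)
qed

text \<open>The exponents \<open>q ^ n / (q - 1)\<close> and \<open>(1 - q ^ n) / (q - 1)\<close>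
  add up to \<open>1 / (q - 1)\<close>, so the norms of the two sequences differ by a nonzero factor
  independent of \<open>n\<close>.\<close>

lemma null_quotient_iff:
  "(\<lambda>n. c n / emb (carlitz_D n)) \<longlonglongrightarrow> 0 \<longleftrightarrow>
    (\<lambda>n. real CARD('a) powr (real CARD('a) ^ n / (real CARD('a) - 1)) * dist (c n) 0) \<longlonglongrightarrow> 0"
proof -
  let ?q = "real CARD('a)"
  have q: "?q > 1" using card_field_gt_1[where 'a = 'a] by simp
  have "?q powr (?q ^ n / (?q - 1)) * dist (c n) 0
      = ?q powr (1 / (?q - 1)) * dist (c n / emb (carlitz_D n)) 0" for n
  proof -
    have "dist (c n / emb (carlitz_D n)) 0 * laurent_abs (carlitz_D n :: 'a fls) = dist (c n) 0"
      by (simp add: carlitz_D_neq_0 flip: dist_emb abs_mult)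
    then have "?q powr (?q ^ n / (?q - 1)) * dist (c n) 0
        = ?q powr (?q ^ n / (?q - 1)) * ?q powr ((1 - ?q ^ n) / (?q - 1))
          * dist (c n / emb (carlitz_D n)) 0"
      by (simp add: laurent_abs_carlitz_D mult_ac)
    also have "?q powr (?q ^ n / (?q - 1)) * ?q powr ((1 - ?q ^ n) / (?q - 1)) = ?q powr (1 / (?q - 1))"
      by (simp flip: powr_add add_divide_distrib)
    finally show ?thesis .
  qed
  moreover have "?q powr (1 / (?q - 1)) \<noteq> 0"
    using q by simp
  ultimately show ?thesis
    by (simp add: tendsto_zero_iff tendsto_mult_left_iff[where l = 0, simplified])
qed

end

theorem theorem3:
  fixes j :: "'a::{finite,field} fls alg_closure \<Rightarrow> 'c::{field,complete_space}"
    and u :: "'a fls \<Rightarrow> 'c"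
    and c :: "nat \<Rightarrow> 'c"
  assumes "completed_alg_closure j"
    and "u \<in> C0_space j"
    and "carlitz_expansion j u c"
  shows "u \<in> A_space j \<longleftrightarrow>
    (\<lambda>n. real CARD('a) powr (real CARD('a) ^ n / (real CARD('a) - 1)) * dist (c n) 0)
      \<longlonglongrightarrow> 0"
proof -
  interpret completed_alg_closure j by fact
  show ?thesis
    using A_space_iff_coeffs[OF assms(3)] null_quotient_iff by blast
qed

end
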